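(* Let $A_0,\dots,A_n\in\mathcal S^p$ be such that the linear copositive system $\mathcal A(\mathbf x)\in\mathcal{COP}^p$ is consistent. Then this system yields the uniform LP duality if and only if $$\mathbf b(k,j)\in\mathrm{cone}\{\mathbf a(\mathbf t):\ \mathbf t\in T\}\quad\text{for all } k\in N_*(j)\text{ and all } j\in J.$$
   Context: Fix integers $p>1$, $n\ge 1$. $\mathcal S^p$ is the space of real symmetric $p\times p$ matrices with $A\bullet B=\mathrm{trace}(AB)$; $\mathbf e_1,\dots,\mathbf e_p$ is the standard basis of $\mathbb R^p$; $\mathbb R^p_+$ is the set of vectors with non-negative components; $P=\{1,\dots,p\}$; $T=\{\mathbf t\in\mathbb R^p_+:\sum_{k\in P} t_k=1\}$. $\mathcal{COP}^p=\{D\in\mathcal S^p:\mathbf t^\top D\mathbf t\ge 0\ \forall \mathbf t\in\mathbb R^p_+\}$ and $\mathcal{CP}^p=\mathrm{conv}\{\mathbf t\mathbf t^\top:\mathbf t\in\mathbb R^p_+\}$. For a set $\mathcal B$, $\mathrm{cone}\,\mathcal B$ is the set of all finite linear combinations of elements of $\mathcal B$ with non-negative coefficients. Given $A_0,\dots,A_n\in\mathcal S^p$, put $\mathcal A(\mathbf x)=A_0+\sum_{m=1}^n x_mA_m$ for $\mathbf x\in\mathbb R^n$ and $X=\{\mathbf x\in\mathbb R^n:\mathcal A(\mathbf x)\in\mathcal{COP}^p\}$. The system $\mathcal A(\mathbf x)\in\mathcal{COP}^p$ is consistent if $X\ne\emptyset$. For $\mathbf c\in\mathbb R^n$ consider the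 primal problem (P): $\min \mathbf c^\top\mathbf x$ s.t. $\mathbf x\in X$, and its Lagrange dual (D): $\max\,(-U\bullet A_0)$ s.t. $U\bullet A_m=c_m$, $m=1,\dots,n$, $U\in\mathcal{CP}^p$; $Val(\cdot)$ denotes the optimal value. A consistent system yields the uniform LP duality if for every $\mathbf c\in\mathbb R^n$ with $Val(\mathrm P)>-\infty$ the dual (D) has an optimal solution and $Val(\mathrm P)=Val(\mathrm D)$. The set of normalized immobile indices is $T_{im}=\{\mathbf t\in T:\mathbf t^\top\mathcal A(\mathbf x)\mathbf t=0\ \forall\mathbf x\in X\}$; it is empty or a finite union of convex bounded polyhedra. $\{\boldsymbol\tau(j):j\in J\}$, $|J|<\infty$, is the set of vertices of $\mathrm{conv}\,T_{im}$ ($J=\emptyset$ if $T_{im}=\emptyset$, and then the displayed condition is regarded as fulfilled). For $j\in J$: $N_*(j)=\{k\in P:\exists\,\mathbf x\in X \text{ with } \mathbf e_k^\top\mathcal A(\mathbf x)\boldsymbol\tau(j)=0\}$. Vectors in $\mathbb R^{n+1}$: $\mathbf a(\mathbf t)=(\mathbf t^\top A_m\mathbf t)_{m=0,\dots,n}$ for $\mathbf t\in T$, and $\mathbf b(k,j)=(\mathbf e_k^\top A_m\boldsymbol\tau(j))_{m=0,\dots,n}$ for $k\in P$, $j\in J$. *)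

theory Defs
  imports "HOL-Analysis.Analysis"
begin

definition sym_matrices :: "(real^'p^'p) set" where
  "sym_matrices = {D. transpose D = D}"

definition mat_inner :: "real^'p^'p \<Rightarrow> real^'p^'p \<Rightarrow> real" where
  "mat_inner A B = trace (A ** B)"

definition nonneg_orthant :: "(real^'p) set" where
  "nonneg_orthant = {t. \<forall>k. 0 \<le> t $ k}"

definition simplex_T :: "(real^'p) set" where
  "simplex_T = {t \<in> nonneg_orthant. (\<Sum>k\<in>UNIV. t $ k) = 1}"

definition COP :: "(real^'p^'p) set" where
  "COP = {D \<in> sym_matrices. \<forall>t\<in>nonneg_orthant. 0 \<le> t \<bullet> (D *v t)}"

definition outer :: "real^'p \<Rightarrow> real^'p^'p" where
  "outer t = (\<chi> i j. t $ i * t $ j)"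

definition CP :: "(real^'p^'p) set" where
  "CP = convex hull (outer ` nonneg_orthant)"

text \<open>The constant \<open>cone\<close> of the library is a predicate on sets, not a hull operator.\<close>

definition cone_gen :: "'a::real_vector set \<Rightarrow> 'a set" where
  "cone_gen B = {(\<Sum>v\<in>F. u v *\<^sub>R v) | F u. finite F \<and> F \<subseteq> B \<and> (\<forall>v\<in>F. (0::real) \<le> u v)}"

lemma cone_gen_eq_hull: "cone_gen B = convex_cone hull B"
proof (rule set_eqI, rule iffI)
  fix x assume "x \<in> cone_gen B"
  then obtain F u where F: "finite F" "F \<subseteq> B" "\<forall>v\<in>F. (0::real) \<le> u v"
    and x: "x = (\<Sum>v\<in>F. u v *\<^sub>R v)"
    unfolding cone_gen_def by blast
  have "(\<Sum>v\<in>F. u v *\<^sub>R v) \<in> convex_cone hull B"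
    using F
  proof (induction F rule: finite_induct)
    case empty
    then show ?case by (simp add: convex_cone_hull_contains_0)
  next
    case (insert a F)
    have "u a *\<^sub>R a \<in> convex_cone hull B"
      using insert.prems
      by (intro convex_cone_scaleR[OF convex_cone_convex_cone_hull] hull_inc) simp_all
    moreover have "(\<Sum>v\<in>F. u v *\<^sub>R v) \<in> convex_cone hull B"
      using insert.prems by (intro insert.IH) simp_all
    ultimately show ?case
      using insert.hyps by (simp add: convex_cone_hull_add)
  qed
  then show "x \<in> convex_cone hull B" using x by simp
next
  have scale: "c *\<^sub>R x \<in> cone_gen B" if xB: "x \<in> cone_gen B" and c: "0 \<le> c" for x :: 'a and c :: real
  proof -
    obtain F u where F: "finite F" "F \<subseteq> B" "\<forall>v\<in>F. (0::real) \<le> u v"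
      and x: "x = (\<Sum>v\<in>F. u v *\<^sub>R v)"
      using xB unfolding cone_gen_def by blast
    have "c *\<^sub>R x = (\<Sum>v\<in>F. (c * u v) *\<^sub>R v)"
      by (simp add: x scaleR_sum_right)
    moreover have "\<forall>v\<in>F. 0 \<le> c * u v" using F(3) c by simp
    ultimately show ?thesis
      unfolding cone_gen_def using F(1,2)
      by (intro CollectI exI[of _ F] exI[of _ "\<lambda>v. c * u v"]) simp
  qed
  have add: "x + y \<in> cone_gen B" if xB: "x \<in> cone_gen B" and yB: "y \<in> cone_gen B" for x y :: 'a
  proof -
    obtain F u where F: "finite F" "F \<subseteq> B" "\<forall>v\<in>F. (0::real) \<le> u v"
      and x: "x = (\<Sum>v\<in>F. u v *\<^sub>R v)"
      using xB unfolding cone_gen_def by blast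
    obtain G w where G: "finite G" "G \<subseteq> B" "\<forall>v\<in>G. (0::real) \<le> w v"
      and y: "y = (\<Sum>v\<in>G. w v *\<^sub>R v)"
      using yB unfolding cone_gen_def by blast
    let ?z = "\<lambda>v. (if v \<in> F then u v else 0) + (if v \<in> G then w v else 0)"
    have 1: "(\<Sum>v\<in>F \<union> G. (if v \<in> F then u v else 0) *\<^sub>R v) = x"
      unfolding x using F(1) G(1) by (intro sum.mono_neutral_cong_right) auto
    have 2: "(\<Sum>v\<in>F \<union> G. (if v \<in> G then w v else 0) *\<^sub>R v) = y"
      unfolding y using F(1) G(1) by (intro sum.mono_neutral_cong_right) auto
    have "x + y = (\<Sum>v\<in>F \<union> G. ?z v *\<^sub>R v)"
      by (simp only: scaleR_left_distrib sum.distrib 1 2)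
    moreover have "\<forall>v\<in>F \<union> G. 0 \<le> ?z v" using F(3) G(3) by simp
    ultimately show ?thesis
      unfolding cone_gen_def using F(1,2) G(1,2)
      by (intro CollectI exI[of _ "F \<union> G"] exI[of _ ?z]) simp
  qed
  have inc: "B \<subseteq> cone_gen B"
  proof
    fix b assume "b \<in> B"
    then show "b \<in> cone_gen B"
      unfolding cone_gen_def
      by (intro CollectI exI[of _ "{b}"] exI[of _ "\<lambda>_. 1"]) simp
  qed
  have zero: "0 \<in> cone_gen B"
    unfolding cone_gen_def by (intro CollectI exI[of _ "{}"]) simp
  have "convex_cone (cone_gen B)"
    using zero add scale unfolding convex_cone_def convex_def conic_def
    by (intro conjI allI ballI impI) auto
  then have "convex_cone hull B \<subseteq> cone_gen B"
    using inc by (rule hull_minimal[rotated])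
  then show "x \<in> cone_gen B" if "x \<in> convex_cone hull B" for x
    using that by blast
qed

definition affine_map :: "real^'p^'p \<Rightarrow> ('n::finite \<Rightarrow> real^'p^'p) \<Rightarrow> real^'n \<Rightarrow> real^'p^'p" where
  "affine_map A0 A x = A0 + (\<Sum>m\<in>UNIV. (x $ m) *\<^sub>R A m)"

definition feasible_X :: "real^'p^'p \<Rightarrow> ('n::finite \<Rightarrow> real^'p^'p) \<Rightarrow> (real^'n) set" where
  "feasible_X A0 A = {x. affine_map A0 A x \<in> COP}"

definition consistent :: "real^'p^'p \<Rightarrow> ('n::finite \<Rightarrow> real^'p^'p) \<Rightarrow> bool" where
  "consistent A0 A \<longleftrightarrow> feasible_X A0 A \<noteq> {}"

definition val_P :: "real^'p^'p \<Rightarrow> ('n::finite \<Rightarrow> real^'p^'p) \<Rightarrow> real^'n \<Rightarrow> ereal" where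
  "val_P A0 A c = (INF x\<in>feasible_X A0 A. ereal (c \<bullet> x))"

definition feasible_D :: "('n::finite \<Rightarrow> real^'p^'p) \<Rightarrow> real^'n \<Rightarrow> (real^'p^'p) set" where
  "feasible_D A c = {U \<in> CP. \<forall>m. mat_inner U (A m) = c $ m}"

definition val_D :: "real^'p^'p \<Rightarrow> ('n::finite \<Rightarrow> real^'p^'p) \<Rightarrow> real^'n \<Rightarrow> ereal" where
  "val_D A0 A c = (SUP U\<in>feasible_D A c. ereal (- mat_inner U A0))"

definition optimal_D ::
  "real^'p^'p \<Rightarrow> ('n::finite \<Rightarrow> real^'p^'p) \<Rightarrow> real^'n \<Rightarrow> real^'p^'p \<Rightarrow> bool" where
  "optimal_D A0 A c U \<longleftrightarrow>
     U \<in> feasible_D A c \<and> (\<forall>V\<in>feasible_D A c. - mat_inner V A0 \<le> - mat_inner U A0)"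

definition uniform_LP_duality :: "real^'p^'p \<Rightarrow> ('n::finite \<Rightarrow> real^'p^'p) \<Rightarrow> bool" where
  "uniform_LP_duality A0 A \<longleftrightarrow>
     (\<forall>c. val_P A0 A c > -\<infinity> \<longrightarrow> (\<exists>U. optimal_D A0 A c U) \<and> val_P A0 A c = val_D A0 A c)"

definition T_im :: "real^'p^'p \<Rightarrow> ('n::finite \<Rightarrow> real^'p^'p) \<Rightarrow> (real^'p) set" where
  "T_im A0 A = {t \<in> simplex_T. \<forall>x\<in>feasible_X A0 A. t \<bullet> (affine_map A0 A x *v t) = 0}"

text \<open>The vertices \<open>\<tau>(j)\<close>, \<open>j \<in> J\<close>, are represented by the set of all of them, i.e. each vertex
  serves as its own index. It is empty if \<^term>\<open>T_im A0 A\<close> is.\<close>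

definition vertices_T_im :: "real^'p^'p \<Rightarrow> ('n::finite \<Rightarrow> real^'p^'p) \<Rightarrow> (real^'p) set" where
  "vertices_T_im A0 A = {\<tau>. \<tau> extreme_point_of (convex hull (T_im A0 A))}"

definition N_star ::
  "real^'p^'p \<Rightarrow> ('n::finite \<Rightarrow> real^'p^'p) \<Rightarrow> real^'p \<Rightarrow> 'p set" where
  "N_star A0 A \<tau> = {k. \<exists>x\<in>feasible_X A0 A. axis k 1 \<bullet> (affine_map A0 A x *v \<tau>) = 0}"

text \<open>A vector of \<open>\<real>\<^sup>n\<^sup>+\<^sup>1\<close> with components \<open>0, \<dots>, n\<close> is the pair of its component \<open>0\<close> and
  the vector of the others.\<close>

definition vec_a ::
  "real^'p^'p \<Rightarrow> ('n::finite \<Rightarrow> real^'p^'p) \<Rightarrow> real^'p \<Rightarrow> real \<times> (real^'n)" where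
  "vec_a A0 A t = (t \<bullet> (A0 *v t), \<chi> m. t \<bullet> (A m *v t))"

definition vec_b ::
  "real^'p^'p \<Rightarrow> ('n::finite \<Rightarrow> real^'p^'p) \<Rightarrow> 'p \<Rightarrow> real^'p \<Rightarrow> real \<times> (real^'n)" where
  "vec_b A0 A k \<tau> = (axis k 1 \<bullet> (A0 *v \<tau>), \<chi> m. axis k 1 \<bullet> (A m *v \<tau>))"

end

theory Submission
  imports Defs
begin

text \<open>
  Write \<open>K\<close> for the cone generated by the vectors \<open>a(t)\<close> and \<open>K'\<close> for the cone of all \<open>(r, c)\<close> such
  that \<open>r + c \<bullet> x \<ge> 0\<close> holds on the feasible set \<open>X\<close>. Since \<open>U \<mapsto> (U \<bullet> A\<^sub>0, U \<bullet> A\<^sub>1, \<dots>)\<close> maps the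
  completely positive cone onto \<open>K\<close> (\<open>pairing_CP\<close>), a dual optimal solution without gap for \<open>c\<close>
  says that \<open>(- Val(P), c)\<close> lies in \<open>K\<close>. Hence uniform duality means that every consequence of the
  system is a combination of finitely many constraints and the trivial inequality \<open>1 \<ge> 0\<close>, i.e. that
  \<open>K' \<subseteq> K + \<real>\<^sub>+ (1, 0)\<close> (\<open>uniform_LP_duality_iff\<close>).

  If \<open>\<tau>\<close> is an immobile index then \<open>\<A>(x) \<tau> \<ge> 0\<close> for every feasible \<open>x\<close>, because the copositive form
  has a minimum at \<open>\<tau>\<close>. So \<open>b(k, \<tau>) \<in> K'\<close>, and under uniform duality \<open>b(k, \<tau>) = a + s (1, 0)\<close> with
  \<open>a \<in> K\<close>, \<open>s \<ge> 0\<close>. If \<open>b(k, \<tau>)\<close> vanishes at some feasible point, then so does \<open>s\<close>; this is the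
  necessity of the condition.

  For sufficiency the system is replaced by an equivalent one that has enough regularity for Farkas'
  lemma. Let \<open>W\<close> be the set of those \<open>w \<in> T\<close> whose support contains the support of no vertex \<open>\<tau>\<close>.
  This set is compact, and by the Krein-Milman theorem it contains no immobile index, so a single
  feasible point makes all constraints \<open>a(w)\<close>, \<open>w \<in> W\<close>, strict (\<open>slater_point\<close>). Subtracting
  multiples of vertices from a nonnegative vector until the rest is proportional to an element of
  \<open>W\<close> or zero shows that the constraints \<open>b(k, \<tau>)\<close>, for all \<open>k\<close> and \<open>\<tau>\<close>, together with \<open>a(w)\<close>, \<open>w \<in> W\<close>,
  define \<open>X\<close> (\<open>copositive_peeling\<close>). Among the former, those with \<open>k \<notin> N\<^sub>*(\<tau>)\<close> are strict on all of
  \<open>X\<close>, so a segment of solutions of the remaining system that starts in \<open>X\<close> cannot leave \<open>X\<close>: they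
  can be dropped (\<open>feasible_X_eq_regular\<close>). There are finitely many vertices, so what remains is a
  finite set of linear constraints and a compact family satisfying a Slater condition, and its
  consequences form the closed cone generated by \<open>(1, 0)\<close> and the constraints (\<open>slater_farkas\<close>). If
  the remaining \<open>b(k, \<tau>)\<close> belong to \<open>K\<close>, this cone is contained in \<open>K + \<real>\<^sub>+ (1, 0)\<close>.
\<close>

section \<open>Closed convex cones\<close>

text \<open>The cone over \<open>S\<close> has a compact base on which \<open>z\<close> is bounded below by some \<open>m > 0\<close>, while \<open>z\<close> is
  nonnegative on the cone of \<open>B\<close>. So an element with \<open>z\<close>-value at most \<open>R\<close> is the sum of an element of
  the closed cone of \<open>B\<close> and one of the compact piece of the cone over \<open>S\<close> with coefficients up to
  \<open>R / m\<close>; locally the cone is therefore closed plus compact. Without \<open>z\<close> the claim fails: the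
  cone over a disc in the plane that has the origin on its boundary is not closed.\<close>

lemma closed_convex_cone_hull_finite_Un_compact:
  fixes B S :: "'a::euclidean_space set"
  assumes "finite B" "compact S"
    and B: "\<And>b. b \<in> B \<Longrightarrow> 0 \<le> z \<bullet> b" and S: "\<And>s. s \<in> S \<Longrightarrow> 0 < z \<bullet> s"
  shows "closed (convex_cone hull (B \<union> S))"
proof (cases "S = {}")
  case True
  then show ?thesis using assms(1) by (simp add: closed_convex_cone_hull)
next
  case False
  let ?C = "convex_cone hull (B \<union> S)"
  define H where "H = convex hull S"
  have H: "compact H" "H \<noteq> {}"
    using False assms(2) by (auto simp: H_def compact_convex_hull)
  have "H \<subseteq> {v. 0 < z \<bullet> v}"
    unfolding H_def using S by (intro hull_minimal convex_halfspace_gt) auto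
  moreover have "continuous_on H (\<lambda>w. z \<bullet> w)" by (intro continuous_intros)
  then obtain w0 where "w0 \<in> H" "\<And>w. w \<in> H \<Longrightarrow> z \<bullet> w0 \<le> z \<bullet> w"
    using continuous_attains_inf[OF H] by blast
  ultimately obtain m where m: "m > 0" "\<And>w. w \<in> H \<Longrightarrow> m \<le> z \<bullet> w"
    by blast
  have zB: "0 \<le> z \<bullet> u" if "u \<in> convex_cone hull B" for u
  proof -
    have "convex_cone hull B \<subseteq> {v. 0 \<le> z \<bullet> v}"
      using B by (intro hull_minimal convex_cone_halfspace_ge) auto
    then show ?thesis using that by auto
  qed
  have C: "v \<in> ?C \<longleftrightarrow> (\<exists>u\<in>convex_cone hull B. \<exists>c\<ge>0. \<exists>w\<in>H. v = u + c *\<^sub>R w)" for v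
    unfolding convex_cone_hull_Un
    using convex_cone_hull_convex_hull_nonempty[OF False] by (auto simp: H_def)
  have "y \<in> ?C" if y: "y \<in> closure ?C" for y
  proof -
    define R where "R = z \<bullet> y + 1"
    define Q where "Q = (\<lambda>(c, w). c *\<^sub>R w) ` ({0..R / m} \<times> H)"
    have "compact Q"
      unfolding Q_def case_prod_unfold
      by (intro compact_continuous_image continuous_intros compact_Times compact_Icc H)
    then have cl: "closed (\<Union>u\<in>convex_cone hull B. \<Union>v\<in>Q. {u + v})"
      using assms(1) by (intro closed_compact_sums closed_convex_cone_hull) auto
    have sub: "{v. z \<bullet> v < R} \<inter> ?C \<subseteq> (\<Union>u\<in>convex_cone hull B. \<Union>v\<in>Q. {u + v})"
    proof
      fix v assume v: "v \<in> {v. z \<bullet> v < R} \<inter> ?C"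
      then obtain u c w where *: "u \<in> convex_cone hull B" "c \<ge> 0" "w \<in> H" "v = u + c *\<^sub>R w"
        using C by auto
      have "c * m \<le> c * (z \<bullet> w)" using * m by (intro mult_left_mono) auto
      also have "\<dots> \<le> z \<bullet> v" using zB[OF *(1)] * by (simp add: inner_add_right)
      also have "\<dots> \<le> R" using v by simp
      finally have "c \<le> R / m" using m by (simp add: field_simps)
      then have "c *\<^sub>R w \<in> Q" unfolding Q_def using *
        by (intro image_eqI[of _ _ "(c, w)"]) auto
      then show "v \<in> (\<Union>u\<in>convex_cone hull B. \<Union>v\<in>Q. {u + v})" using * by blast
    qed
    have "y \<in> {v. z \<bullet> v < R} \<inter> closure ?C" using y by (simp add: R_def)
    also have "\<dots> \<subseteq> closure ({v. z \<bullet> v < R} \<inter> ?C)"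
      by (intro open_Int_closure_subset open_halfspace_lt)
    also have "\<dots> \<subseteq> (\<Union>u\<in>convex_cone hull B. \<Union>v\<in>Q. {u + v})"
      using sub cl by (rule closure_minimal)
    also have "\<dots> \<subseteq> ?C"
    proof
      fix v assume "v \<in> (\<Union>u\<in>convex_cone hull B. \<Union>v\<in>Q. {u + v})"
      then obtain u c w where "u \<in> convex_cone hull B" "c \<ge> 0" "w \<in> H" "v = u + c *\<^sub>R w"
        by (auto simp: Q_def)
      then show "v \<in> ?C" using C by blast
    qed
    finally show ?thesis .
  qed
  then show ?thesis using closure_subset_eq by blast
qed

text \<open>The bipolar theorem: separating a point from a cone by a hyperplane, the cone must lie on the
  nonnegative side of the parallel hyperplane through the origin, since a negative value on it could
  be scaled below any bound.\<close>

lemma mem_closed_convex_coneI: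
  fixes y :: "'a::euclidean_space"
  assumes "closed C" "convex_cone C"
    and dual: "\<And>z. (\<And>v. v \<in> C \<Longrightarrow> 0 \<le> z \<bullet> v) \<Longrightarrow> 0 \<le> z \<bullet> y"
  shows "y \<in> C"
proof (rule ccontr)
  assume "y \<notin> C"
  then obtain z b where z: "z \<bullet> y < b" "\<And>v. v \<in> C \<Longrightarrow> b < z \<bullet> v"
    using separating_hyperplane_closed_point[of C y] assms by (auto simp: convex_cone_def)
  have b: "b < 0" using z(2)[OF convex_cone_contains_0[OF assms(2)]] by simp
  have "0 \<le> z \<bullet> v" if v: "v \<in> C" for v
  proof (rule ccontr)
    assume neg: "\<not> 0 \<le> z \<bullet> v"
    have "b < z \<bullet> ((b / (z \<bullet> v)) *\<^sub>R v)"
      using neg b by (intro z(2) convex_cone_scaleR[OF assms(2)] v divide_nonpos_neg) auto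
    then show False using neg by simp
  qed
  then show False using dual[of z] z(1) b by simp
qed

section \<open>Copositive matrices and their zeros\<close>

lemma sym_matrix_inner_commute:
  assumes "D \<in> sym_matrices"
  shows "u \<bullet> (D *v v) = v \<bullet> (D *v u)"
  using assms unfolding sym_matrices_def
  by (metis (mono_tags) dot_lmul_matrix inner_commute mem_Collect_eq transpose_matrix_vector)

lemma sym_matrix_form_add_scaleR:
  assumes "D \<in> sym_matrices"
  shows "(t + s *\<^sub>R u) \<bullet> (D *v (t + s *\<^sub>R u))
    = t \<bullet> (D *v t) + 2 * s * (u \<bullet> (D *v t)) + s\<^sup>2 * (u \<bullet> (D *v u))"
  using sym_matrix_inner_commute[OF assms, of t u]
  by (simp add: matrix_vector_right_distrib matrix_vector_mult_scaleR inner_add_left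
      inner_add_right power2_eq_square algebra_simps)

lemma nonneg_orthant_add: "u \<in> nonneg_orthant \<Longrightarrow> v \<in> nonneg_orthant \<Longrightarrow> u + v \<in> nonneg_orthant"
  and nonneg_orthant_scaleR: "0 \<le> c \<Longrightarrow> u \<in> nonneg_orthant \<Longrightarrow> c *\<^sub>R u \<in> nonneg_orthant"
  and axis_in_nonneg_orthant: "axis k 1 \<in> nonneg_orthant"
  by (auto simp: nonneg_orthant_def axis_def)

text \<open>A zero \<open>t\<close> minimizes the form over the orthant, so its directional derivative
  \<open>2 u\<^sup>T D t\<close> towards any \<open>u \<ge> 0\<close> is nonnegative.\<close>

lemma copositive_zero_gradient:
  assumes D: "D \<in> COP" and t: "t \<in> nonneg_orthant" "t \<bullet> (D *v t) = 0"
    and u: "u \<in> nonneg_orthant"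
  shows "0 \<le> u \<bullet> (D *v t)"
proof (rule ccontr)
  assume neg: "\<not> 0 \<le> u \<bullet> (D *v t)"
  define a where "a = u \<bullet> (D *v t)"
  define q where "q = u \<bullet> (D *v u)"
  \<comment> \<open>A step with \<open>s q \<le> - a\<close>, so short that the linear term \<open>2 s a < 0\<close> outweighs \<open>s\<^sup>2 q\<close>.\<close>
  define s where "s = - a / (q + 1)"
  have q: "0 \<le> q" using D u by (auto simp: COP_def q_def)
  have a: "a < 0" using neg by (simp add: a_def)
  have s: "s > 0" using a q by (auto simp: s_def intro!: divide_neg_pos)
  have "0 \<le> (t + s *\<^sub>R u) \<bullet> (D *v (t + s *\<^sub>R u))"
    using D s t(1) u nonneg_orthant_add nonneg_orthant_scaleR
    by (metis (no_types, lifting) COP_def less_imp_le mem_Collect_eq)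
  also have "\<dots> = 2 * s * a + s\<^sup>2 * q"
    using D t by (simp add: COP_def sym_matrix_form_add_scaleR a_def q_def)
  also have "\<dots> = s * (2 * a + s * q)" by (simp add: power2_eq_square algebra_simps)
  finally have "0 \<le> 2 * a + s * q" using s by (simp add: zero_le_mult_iff)
  moreover have "s * q \<le> - a"
    using q a by (simp add: s_def field_simps)
  ultimately show False using a by simp
qed

text \<open>Complementary slackness: \<open>t \<ge> 0\<close>, \<open>D t \<ge> 0\<close> and \<open>t\<^sup>T D t = 0\<close> make \<open>D t\<close> vanish on the support
  of \<open>t\<close>.\<close>

lemma copositive_zero_gradient_support:
  assumes D: "D \<in> COP" and t: "t \<in> nonneg_orthant" "t \<bullet> (D *v t) = 0"
    and supp: "\<And>k. t $ k = 0 \<Longrightarrow> u $ k = 0"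
  shows "u \<bullet> (D *v t) = 0"
proof -
  have nn: "0 \<le> (D *v t) $ k" for k
    using copositive_zero_gradient[OF D t axis_in_nonneg_orthant[of k]]
    by (simp add: inner_axis')
  have "(\<Sum>k\<in>UNIV. t $ k * (D *v t) $ k) = 0"
    using t(2) by (simp add: inner_vec_def)
  then have "\<forall>k\<in>UNIV. t $ k * (D *v t) $ k = 0"
    using nn t(1) by (subst (asm) sum_nonneg_eq_0_iff) (auto simp: nonneg_orthant_def)
  then have *: "u $ k * (D *v t) $ k = 0" for k using supp[of k] by auto
  show ?thesis unfolding inner_vec_def inner_real_def by (intro sum.neutral ballI *)
qed

lemma simplex_T_in_nonneg_orthant: "t \<in> simplex_T \<Longrightarrow> t \<in> nonneg_orthant"
  by (simp add: simplex_T_def)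

lemma nonneg_orthant_normalize:
  assumes "t \<in> nonneg_orthant" "t \<noteq> 0"
  obtains s u where "s > 0" "u \<in> simplex_T" "t = s *\<^sub>R u"
proof -
  define s where "s = (\<Sum>k\<in>UNIV. t $ k)"
  have "s \<ge> 0" using assms(1) by (auto simp: s_def nonneg_orthant_def intro: sum_nonneg)
  moreover have "s \<noteq> 0"
  proof
    assume "s = 0"
    then have "\<forall>k\<in>UNIV. t $ k = 0"
      using assms(1) unfolding s_def
      by (subst (asm) sum_nonneg_eq_0_iff) (auto simp: nonneg_orthant_def)
    then show False using assms(2) by (simp add: vec_eq_iff)
  qed
  ultimately have s: "s > 0" by simp
  show ?thesis
  proof
    show "s > 0" by fact
    show "(1 / s) *\<^sub>R t \<in> simplex_T"
      using s assms(1)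
      by (auto simp: simplex_T_def nonneg_orthant_def s_def sum_divide_distrib[symmetric])
    show "t = s *\<^sub>R ((1 / s) *\<^sub>R t)" using s by simp
  qed
qed

text \<open>With \<open>V\<close> the vertices of the immobile set, excluding supports rather than a neighbourhood keeps
  this set away from the immobile indices, and still leaves it large enough to contain, up to scaling,
  what remains of a nonnegative vector after multiples of vertices have been subtracted from it.\<close>

definition supp_free :: "(real^'p) set \<Rightarrow> (real^'p) set" where
  "supp_free V = {w \<in> simplex_T. \<forall>\<tau>\<in>V. \<exists>k. \<tau> $ k \<noteq> 0 \<and> w $ k = 0}"

text \<open>If the support of \<open>t\<close> contains that of \<open>\<tau> \<in> V\<close>, write \<open>t = r + \<alpha> \<tau>\<close> with the largest \<open>\<alpha>\<close> that
  keeps \<open>r \<ge> 0\<close>. The support of \<open>r\<close> is smaller, and in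
  \<open>t\<^sup>T D t = r\<^sup>T D r + 2 \<alpha> r\<^sup>T D \<tau> + \<alpha>\<^sup>2 \<tau>\<^sup>T D \<tau>\<close> the last two terms are nonnegative because
  \<open>D \<tau> \<ge> 0\<close>. When no further \<open>\<tau>\<close> can be subtracted, the rest is zero or a multiple of an element of
  \<open>supp_free V\<close>.\<close>

lemma copositive_peeling:
  assumes sym: "D \<in> sym_matrices" and V: "V \<subseteq> simplex_T"
    and grad: "\<And>\<tau> k. \<tau> \<in> V \<Longrightarrow> 0 \<le> axis k 1 \<bullet> (D *v \<tau>)"
    and free: "\<And>w. w \<in> supp_free V \<Longrightarrow> 0 \<le> w \<bullet> (D *v w)"
  shows "D \<in> COP"
proof -
  have grad': "0 \<le> u \<bullet> (D *v \<tau>)" if "\<tau> \<in> V" "u \<in> nonneg_orthant" for u \<tau>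
    using that(2) grad[OF that(1)]
    unfolding inner_axis' inner_vec_def[of u] nonneg_orthant_def by (auto intro!: sum_nonneg)
  have "0 \<le> t \<bullet> (D *v t)" if "t \<in> nonneg_orthant" for t
    using that
  proof (induction "card {k. t $ k \<noteq> 0}" arbitrary: t rule: less_induct)
    case less
    show ?case
    proof (cases "t = 0")
      case False
      then obtain s u where su: "s > 0" "u \<in> simplex_T" "t = s *\<^sub>R u"
        using nonneg_orthant_normalize[OF less.prems] by blast
      show ?thesis
      proof (cases "u \<in> supp_free V")
        case True
        then show ?thesis using free[OF True] su
          by (simp add: matrix_vector_mult_scaleR)
      next
        case F: False
        then obtain \<tau> where \<tau>: "\<tau> \<in> V" "\<And>k. \<tau> $ k \<noteq> 0 \<Longrightarrow> t $ k \<noteq> 0"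
          using su by (auto simp: supp_free_def)
        have \<tau>nn: "\<tau> $ k \<ge> 0" for k using \<tau>(1) V by (auto simp: simplex_T_def nonneg_orthant_def)
        have tnn: "t $ k \<ge> 0" for k using less.prems by (auto simp: nonneg_orthant_def)
        define I where "I = {k. \<tau> $ k \<noteq> 0}"
        have "I \<noteq> {}"
          using \<tau>(1) V by (force simp: I_def simplex_T_def)
        then obtain i where i: "i \<in> I" "\<And>k. k \<in> I \<Longrightarrow> t $ i / \<tau> $ i \<le> t $ k / \<tau> $ k"
          using ex_min_if_finite[of "(\<lambda>k. t $ k / \<tau> $ k) ` I"] by (auto simp: not_less)
        define \<alpha> where "\<alpha> = t $ i / \<tau> $ i"
        define r where "r = t - \<alpha> *\<^sub>R \<tau>"
        have \<alpha>: "\<alpha> \<ge> 0" using tnn \<tau>nn by (simp add: \<alpha>_def)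
        have rnn: "r \<in> nonneg_orthant"
          unfolding nonneg_orthant_def
        proof (intro CollectI allI)
          fix k
          show "0 \<le> r $ k"
          proof (cases "k \<in> I")
            case True
            then have "\<tau> $ k > 0" using \<tau>nn[of k] by (simp add: I_def)
            then show ?thesis using i(2)[OF True] by (simp add: r_def \<alpha>_def field_simps)
          next
            case False
            then show ?thesis using tnn by (simp add: r_def I_def)
          qed
        qed
        have "{k. r $ k \<noteq> 0} \<subset> {k. t $ k \<noteq> 0}"
        proof
          show "{k. r $ k \<noteq> 0} \<subseteq> {k. t $ k \<noteq> 0}" using \<tau>(2) by (auto simp: r_def)
          have "r $ i = 0" "t $ i \<noteq> 0" using i(1) \<tau>(2)[of i] by (auto simp: r_def \<alpha>_def I_def)
          then show "{k. r $ k \<noteq> 0} \<noteq> {k. t $ k \<noteq> 0}" by blast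
        qed
        then have "0 \<le> r \<bullet> (D *v r)"
          using rnn by (intro less.hyps psubset_card_mono) auto
        moreover have "0 \<le> \<tau> \<bullet> (D *v r)"
          using grad'[OF \<tau>(1) rnn] sym_matrix_inner_commute[OF sym, of r \<tau>] by simp
        moreover have "0 \<le> \<tau> \<bullet> (D *v \<tau>)"
          using grad'[OF \<tau>(1)] \<tau>(1) V simplex_T_in_nonneg_orthant by blast
        moreover have "t = r + \<alpha> *\<^sub>R \<tau>" by (simp add: r_def)
        ultimately show ?thesis using \<alpha>
          by (simp only: sym_matrix_form_add_scaleR[OF sym]) (intro add_nonneg_nonneg mult_nonneg_nonneg; simp)
      qed
    qed simp
  qed
  then show ?thesis using sym by (simp add: COP_def)
qed

lemma closed_coordinate_zero: "closed {t::real^'p. t $ k = 0}"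
  by (intro closed_Collect_eq continuous_intros)

lemma compact_simplex_T: "compact (simplex_T :: (real^'p) set)"
proof -
  have "(simplex_T :: (real^'p) set) = (\<Inter>k. {t. 0 \<le> t $ k}) \<inter> {t. (\<Sum>k\<in>UNIV. t $ k) = 1}"
    by (auto simp: simplex_T_def nonneg_orthant_def)
  moreover have "closed \<dots>"
    by (intro closed_Int closed_INT ballI closed_Collect_le closed_Collect_eq continuous_intros)
  moreover have "bounded (simplex_T :: (real^'p) set)"
  proof (rule boundedI)
    fix t :: "real^'p" assume t: "t \<in> simplex_T"
    have "norm t \<le> (\<Sum>k\<in>UNIV. \<bar>t $ k\<bar>)" by (rule norm_le_l1_cart)
    also have "\<dots> = 1" using t by (simp add: simplex_T_def nonneg_orthant_def)
    finally show "norm t \<le> 1" .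
  qed
  ultimately show ?thesis by (simp add: compact_eq_bounded_closed)
qed

text \<open>A support can only shrink in a limit, so not containing a given support is a closed condition.\<close>

lemma compact_supp_free: "compact (supp_free V)"
proof -
  have "supp_free V = simplex_T \<inter> (\<Inter>\<tau>\<in>V. \<Union>k\<in>{k. \<tau> $ k \<noteq> 0}. {w. w $ k = 0})"
    by (auto simp: supp_free_def)
  also have "compact \<dots>"
    by (intro compact_Int_closed compact_simplex_T closed_INT ballI closed_UN
        closed_coordinate_zero) auto
  finally show ?thesis .
qed

section \<open>The constraint vectors of a copositive system\<close>

text \<open>The common polarization of the vectors \<open>a(t)\<close> and \<open>b(k, \<tau>)\<close>.\<close>

definition coeffs ::
  "real^'p^'p \<Rightarrow> ('n::finite \<Rightarrow> real^'p^'p) \<Rightarrow> real^'p \<Rightarrow> real^'p \<Rightarrow> real \<times> (real^'n)" where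
  "coeffs A0 A u v = (u \<bullet> (A0 *v v), \<chi> m. u \<bullet> (A m *v v))"

lemma vec_a_eq: "vec_a A0 A t = coeffs A0 A t t"
  and vec_b_eq: "vec_b A0 A k \<tau> = coeffs A0 A (axis k 1) \<tau>"
  by (simp_all add: vec_a_def vec_b_def coeffs_def)

lemma sum_matrix_vector_mult: "(\<Sum>m\<in>S. B m) *v v = (\<Sum>m\<in>S. B m *v (v::real^'p))"
  by (induction S rule: infinite_finite_induct)
    (simp_all add: matrix_vector_mult_add_rdistrib)

text \<open>Pairing with the lifted point \<open>(1, x)\<close> evaluates the form of \<open>\<A>(x)\<close>; this turns every statement
  on copositivity into one on linear inequalities in \<open>x\<close>.\<close>

lemma coeffs_inner: "coeffs A0 A u v \<bullet> (1, x) = u \<bullet> (affine_map A0 A x *v v)"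
proof -
  have "u \<bullet> (affine_map A0 A x *v v) = u \<bullet> (A0 *v v) + (\<Sum>m\<in>UNIV. x $ m * (u \<bullet> (A m *v v)))"
    by (simp add: affine_map_def matrix_vector_mult_add_rdistrib sum_matrix_vector_mult
        inner_add_right inner_sum_right scaleR_matrix_vector_assoc[symmetric])
  then show ?thesis
    by (simp add: coeffs_def inner_vec_def mult.commute)
qed

lemma continuous_vec_a: "continuous_on S (vec_a A0 A)"
  unfolding vec_a_def
  by (intro continuous_intros linear_continuous_on_compose matrix_vector_mul_linear)

lemma mat_inner_outer: "mat_inner (outer t) B = t \<bullet> (B *v t)"
  by (simp add: mat_inner_def trace_def matrix_matrix_mult_def outer_def inner_vec_def
      matrix_vector_mult_def sum_distrib_left) 
    (subst sum.swap, simp add: mult_ac)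

definition pairing :: "real^'p^'p \<Rightarrow> ('n::finite \<Rightarrow> real^'p^'p) \<Rightarrow> real^'p^'p \<Rightarrow> real \<times> (real^'n)" where
  "pairing A0 A U = (mat_inner U A0, \<chi> m. mat_inner U (A m))"

lemma linear_pairing: "linear (pairing A0 A)"
proof -
  have add: "mat_inner (U + U') B = mat_inner U B + mat_inner U' B" for U U' B :: "real^'p^'p"
    by (simp add: mat_inner_def trace_def matrix_matrix_mult_def sum.distrib distrib_right)
  have sc: "mat_inner (r *\<^sub>R U) B = r * mat_inner U B" for r and U B :: "real^'p^'p"
    by (simp add: mat_inner_def trace_def matrix_matrix_mult_def sum_distrib_left mult.assoc)
  show ?thesis
    by (intro linearI) (auto simp: pairing_def add sc vec_eq_iff)
qed

lemma CP_eq_convex_cone_hull: "CP = convex_cone hull (outer ` (simplex_T :: (real^'p) set))"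
proof
  have sc: "outer (c *\<^sub>R t) = c\<^sup>2 *\<^sub>R outer t" for c and t :: "real^'p"
    by (simp add: outer_def vec_eq_iff power2_eq_square)
  have "outer t \<in> convex_cone hull (outer ` simplex_T)" if t: "t \<in> nonneg_orthant" for t :: "real^'p"
  proof (cases "t = 0")
    case True
    then have "outer t = 0" using sc[of 0 t] by simp
    then show ?thesis by (simp add: convex_cone_hull_contains_0)
  next
    case False
    then obtain s u where "s > 0" "u \<in> simplex_T" "t = s *\<^sub>R u"
      using nonneg_orthant_normalize[OF t] by blast
    then show ?thesis by (simp only: sc) (intro convex_cone_hull_mul hull_inc imageI; simp)
  qed
  then show "CP \<subseteq> convex_cone hull (outer ` (simplex_T :: (real^'p) set))"
    unfolding CP_def by (intro hull_minimal convex_convex_cone_hull) auto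
  have conic: "conic (outer ` (nonneg_orthant :: (real^'p) set))"
    unfolding conic_def
  proof clarify
    fix t :: "real^'p" and c :: real assume "t \<in> nonneg_orthant" "0 \<le> c"
    then show "c *\<^sub>R outer t \<in> outer ` nonneg_orthant"
      using sc[of "sqrt c" t] by (intro image_eqI[of _ _ "sqrt c *\<^sub>R t"] nonneg_orthant_scaleR) auto
  qed
  then have "convex_cone (CP :: (real^'p^'p) set)"
    unfolding convex_cone_def conic_def
  proof (intro conjI ballI allI impI)
    show "convex (CP :: (real^'p^'p) set)" unfolding CP_def by (rule convex_convex_hull)
    show "(CP :: (real^'p^'p) set) \<noteq> {}" unfolding CP_def using axis_in_nonneg_orthant by auto
    fix U :: "real^'p^'p" and c :: real assume U: "U \<in> CP" and c: "0 \<le> c"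
    have "c *\<^sub>R U \<in> convex hull ((*\<^sub>R) c ` outer ` nonneg_orthant)"
      using U unfolding convex_hull_scaling CP_def by blast
    also have "\<dots> \<subseteq> CP"
      unfolding CP_def using conic c
      by (intro hull_mono) (auto simp: conic_def)
    finally show "c *\<^sub>R U \<in> CP" .
  qed
  then show "convex_cone hull (outer ` (simplex_T :: (real^'p) set)) \<subseteq> CP"
    by (intro hull_minimal)
      (auto simp: CP_def intro!: hull_inc simplex_T_in_nonneg_orthant)
qed

text \<open>This is where matrices leave the argument: dual feasible points become elements of the cone of the
  \<open>a(t)\<close>.\<close>

lemma pairing_CP: "pairing A0 A ` CP = cone_gen (vec_a A0 A ` simplex_T)"
proof -
  have "pairing A0 A ` outer ` simplex_T = vec_a A0 A ` simplex_T"
    unfolding image_image by (simp add: pairing_def mat_inner_outer vec_a_def)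
  then show ?thesis
    unfolding CP_eq_convex_cone_hull cone_gen_eq_hull
    by (metis convex_cone_hull_linear_image linear_pairing)
qed

section \<open>Farkas' lemma for semi-infinite systems\<close>

text \<open>A pair \<open>(r, c)\<close> stands for the affine inequality \<open>r + c \<bullet> x \<ge> 0\<close>.\<close>

definition solutions :: "(real \<times> 'a::real_inner) set \<Rightarrow> 'a set" where
  "solutions G = {x. \<forall>g\<in>G. 0 \<le> g \<bullet> (1, x)}"

definition consequences :: "'a::real_inner set \<Rightarrow> (real \<times> 'a) set" where
  "consequences S = {y. \<forall>x\<in>S. 0 \<le> y \<bullet> (1, x)}"

lemma inner_lift_convex:
  "y \<bullet> (1::real, (1 - u) *\<^sub>R a + u *\<^sub>R b) = (1 - u) * (y \<bullet> (1, a)) + u * (y \<bullet> (1, b))"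
  by (cases y) (simp add: inner_add_right algebra_simps)

lemma convex_solutions: "convex (solutions G)"
  unfolding convex_alt solutions_def by (auto simp: inner_lift_convex)

lemma closed_solutions: "closed (solutions (G :: (real \<times> 'a::euclidean_space) set))"
proof -
  have "solutions G = (\<Inter>g\<in>G. {x. 0 \<le> g \<bullet> (1, x)})"
    by (auto simp: solutions_def)
  then show ?thesis
    by (auto intro!: closed_INT closed_Collect_le continuous_intros)
qed

lemma convex_cone_hull_subset_consequences: "convex_cone hull G \<subseteq> consequences (solutions G)"
proof -
  have "convex_cone hull G \<subseteq> {y. 0 \<le> (1, x) \<bullet> y}" if "x \<in> solutions G" for x
    using that by (intro hull_minimal convex_cone_halfspace_ge)
      (auto simp: solutions_def inner_commute)
  then show ?thesis unfolding consequences_def by (auto simp: inner_commute)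
qed

lemma mem_convex_cone_hull_insert_unit:
  "y \<in> convex_cone hull (insert (1, 0) G) \<longleftrightarrow> (\<exists>s\<ge>0. y - (s, 0) \<in> convex_cone hull G)"
  for G :: "(real \<times> 'a::euclidean_space) set"
proof -
  have 1: "z \<in> convex_cone hull {(1::real, 0::'a)} \<longleftrightarrow> (\<exists>s\<ge>0. z = (s, 0))" for z
    by (auto simp: convex_cone_hull_convex_hull zero_prod_def)
  have "y \<in> convex_cone hull ({(1, 0)} \<union> G) \<longleftrightarrow> (\<exists>s\<ge>0. \<exists>g\<in>convex_cone hull G. y = (s, 0) + g)"
    unfolding convex_cone_hull_Un by (auto simp: Bex_def 1)
  also have "\<dots> \<longleftrightarrow> (\<exists>s\<ge>0. y - (s, 0) \<in> convex_cone hull G)"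
    by (metis add_diff_cancel_left' add.commute diff_add_cancel)
  finally show ?thesis by simp
qed

text \<open>The Slater point \<open>x0\<close>, lifted to \<open>(1, x0)\<close>, makes the cone on the right closed, so it suffices to
  test a consequence \<open>y\<close> on the elements \<open>(r, d)\<close> of its dual cone. Here \<open>r \<ge> 0\<close> by the generator
  \<open>(1, 0)\<close>. For \<open>r > 0\<close> the point \<open>d / r\<close> is a solution; for \<open>r = 0\<close> the vector \<open>d\<close> is a recession
  direction, and \<open>y\<close> stays nonnegative along the ray from \<open>x0\<close> in this direction.\<close>

lemma slater_farkas:
  fixes B S :: "(real \<times> 'a::euclidean_space) set"
  assumes "finite B" "compact S" and x0: "x0 \<in> solutions B" "\<And>s. s \<in> S \<Longrightarrow> 0 < s \<bullet> (1, x0)"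
  shows "consequences (solutions (B \<union> S)) \<subseteq> convex_cone hull (insert (1, 0) (B \<union> S))"
proof
  let ?C = "convex_cone hull (insert (1, 0) (B \<union> S))"
  fix y assume y: "y \<in> consequences (solutions (B \<union> S))"
  have "closed (convex_cone hull (B \<union> insert (1, 0) S))"
    using assms by (intro closed_convex_cone_hull_finite_Un_compact[where z = "(1, x0)"])
      (auto simp: solutions_def inner_commute)
  then have closed: "closed ?C" by simp
  have x0': "x0 \<in> solutions (B \<union> S)" using x0 by (auto simp: solutions_def intro: less_imp_le)
  show "y \<in> ?C"
  proof (rule mem_closed_convex_coneI[OF closed convex_cone_convex_cone_hull])
    fix z assume dual: "\<And>v. v \<in> ?C \<Longrightarrow> 0 \<le> z \<bullet> v"
    obtain r d where z: "z = (r, d)" by (cases z)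
    have r: "r \<ge> 0" using dual[OF hull_inc, of "(1, 0)"] by (simp add: z)
    have zG: "0 \<le> g \<bullet> z" if "g \<in> B \<union> S" for g
      using dual[OF hull_inc, of g] that by (simp add: inner_commute)
    show "0 \<le> z \<bullet> y"
    proof (cases "r = 0")
      case False
      then have zr: "z = r *\<^sub>R (1, (1 / r) *\<^sub>R d)" by (simp add: z)
      have "(1 / r) *\<^sub>R d \<in> solutions (B \<union> S)"
        unfolding solutions_def
      proof (intro CollectI ballI)
        fix g assume "g \<in> B \<union> S"
        from zG[OF this] have "0 \<le> r * (g \<bullet> (1, (1 / r) *\<^sub>R d))"
          by (subst (asm) zr) (simp only: inner_scaleR_right)
        then show "0 \<le> g \<bullet> (1, (1 / r) *\<^sub>R d)" using r False by (simp add: zero_le_mult_iff)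
      qed
      then have "0 \<le> y \<bullet> (1, (1 / r) *\<^sub>R d)" using y by (auto simp: consequences_def)
      then have "0 \<le> r * (y \<bullet> (1, (1 / r) *\<^sub>R d))" using r by simp
      then show ?thesis by (subst inner_commute, subst zr) (simp only: inner_scaleR_right)
    next
      case True
      have lift: "g \<bullet> (1, x0 + c *\<^sub>R d) = g \<bullet> (1, x0) + c * (g \<bullet> z)" for g c
        using True by (cases g) (simp add: z inner_add_right)
      have ray: "0 \<le> y \<bullet> (1, x0) + c * (y \<bullet> z)" if "c \<ge> 0" for c
      proof -
        have "x0 + c *\<^sub>R d \<in> solutions (B \<union> S)"
          using x0' zG that unfolding solutions_def by (auto simp: lift simp del: inner_Pair)
        then show ?thesis using y lift by (metis (no_types, lifting) consequences_def mem_Collect_eq)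
      qed
      show ?thesis
      proof (rule ccontr)
        assume "\<not> 0 \<le> z \<bullet> y"
        then have neg: "y \<bullet> z < 0" by (simp add: inner_commute)
        have "0 \<le> y \<bullet> (1, x0)" using ray[of 0] by simp
        \<comment> \<open>With this step length \<open>y\<close> takes the value \<open>- 1\<close> on the ray.\<close>
        then have "0 \<le> (y \<bullet> (1, x0) + 1) / - (y \<bullet> z)" using neg by (intro divide_nonneg_pos) auto
        from ray[OF this] show False using neg by simp
      qed
    qed
  qed
qed

section \<open>Immobile indices\<close>

lemma sym_matrices_iff: "D \<in> sym_matrices \<longleftrightarrow> (\<forall>i j. D $ i $ j = D $ j $ i)"
  by (auto simp: sym_matrices_def transpose_def vec_eq_iff)

locale copositive_system =
  fixes A0 :: "real^'p^'p" and A :: "'n::finite \<Rightarrow> real^'p^'p"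
  assumes A0_sym: "A0 \<in> sym_matrices" and A_sym: "\<And>m. A m \<in> sym_matrices"
    and consistent: "consistent A0 A"
begin

abbreviation "X \<equiv> feasible_X A0 A"
abbreviation "V \<equiv> vertices_T_im A0 A"

lemma affine_map_sym: "affine_map A0 A x \<in> sym_matrices"
proof -
  have "A0 $ i $ j = A0 $ j $ i" "A m $ i $ j = A m $ j $ i" for m i j
    using A0_sym A_sym by (auto simp: sym_matrices_iff)
  then show ?thesis
    unfolding sym_matrices_iff affine_map_def by (simp add: sum_component)
qed

lemma feasible_X_eq_solutions: "X = solutions (vec_a A0 A ` simplex_T)"
proof (intro set_eqI iffI)
  fix x assume "x \<in> X"
  then show "x \<in> solutions (vec_a A0 A ` simplex_T)"
    by (auto simp: feasible_X_def COP_def solutions_def vec_a_eq coeffs_inner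
        simplex_T_in_nonneg_orthant)
next
  fix x assume x: "x \<in> solutions (vec_a A0 A ` simplex_T)"
  have "affine_map A0 A x \<in> COP"
    by (rule copositive_peeling[OF affine_map_sym, of "{}"])
      (use x in \<open>auto simp: supp_free_def solutions_def vec_a_eq coeffs_inner\<close>)
  then show "x \<in> X" by (simp add: feasible_X_def)
qed

lemma T_im_zero:
  assumes "t \<in> T_im A0 A" "x \<in> X"
  shows "affine_map A0 A x \<in> COP" "t \<in> nonneg_orthant" "t \<bullet> (affine_map A0 A x *v t) = 0"
  using assms by (auto simp: T_im_def feasible_X_def simplex_T_in_nonneg_orthant)

lemma vertex_in_T_im: "\<tau> \<in> V \<Longrightarrow> \<tau> \<in> T_im A0 A"
  unfolding vertices_T_im_def using extreme_point_of_convex_hull by blast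

lemma vertex_in_simplex_T: "\<tau> \<in> V \<Longrightarrow> \<tau> \<in> simplex_T"
  using vertex_in_T_im by (auto simp: T_im_def)

lemma vec_b_nonneg:
  assumes "\<tau> \<in> V" "x \<in> X"
  shows "0 \<le> vec_b A0 A k \<tau> \<bullet> (1, x)"
  using copositive_zero_gradient[OF T_im_zero[OF vertex_in_T_im[OF assms(1)] assms(2)]
      axis_in_nonneg_orthant]
  by (simp add: vec_b_eq coeffs_inner)

lemma compact_T_im: "compact (T_im A0 A)"
proof -
  have "T_im A0 A = simplex_T \<inter> (\<Inter>x\<in>X. {t. t \<bullet> (affine_map A0 A x *v t) = 0})"
    by (auto simp: T_im_def)
  also have "compact \<dots>"
    by (intro compact_Int_closed compact_simplex_T closed_INT ballI closed_Collect_eq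
        continuous_intros linear_continuous_on_compose matrix_vector_mul_linear)
  finally show ?thesis .
qed

text \<open>By the Krein-Milman theorem \<open>t\<close> is a convex combination of vertices, and as these are nonnegative,
  those with positive weight are supported in the support of \<open>t\<close>. The vector \<open>z\<close> of the proof
  indicates the complement of that support: if it were positive on all vertices, then it would be
  positive at \<open>t\<close>.\<close>

lemma immobile_index_supports_vertex:
  assumes t: "t \<in> T_im A0 A"
  obtains \<tau> where "\<tau> \<in> V" "\<And>k. t $ k = 0 \<Longrightarrow> \<tau> $ k = 0"
proof -
  have "\<exists>\<tau>\<in>V. \<forall>k. t $ k = 0 \<longrightarrow> \<tau> $ k = 0"
  proof (rule ccontr)
    assume none: "\<not> ?thesis"
    define z :: "real^'p" where "z = (\<chi> k. if t $ k = 0 then 1 else 0)"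
    have "V \<subseteq> {u. 0 < z \<bullet> u}"
    proof
      fix \<tau> assume \<tau>: "\<tau> \<in> V"
      then obtain k where k: "t $ k = 0" "\<tau> $ k \<noteq> 0" using none by blast
      have nn: "0 \<le> \<tau> $ i" for i
        using vertex_in_simplex_T[OF \<tau>] by (auto simp: simplex_T_def nonneg_orthant_def)
      have "0 < (\<Sum>i\<in>UNIV. z $ i * \<tau> $ i)"
        using k nn[of k] by (intro sum_pos2[of _ k]) (auto simp: z_def nn less_le)
      then show "\<tau> \<in> {u. 0 < z \<bullet> u}" by (simp add: inner_vec_def)
    qed
    then have "convex hull V \<subseteq> {u. 0 < z \<bullet> u}"
      by (intro hull_minimal convex_halfspace_gt)
    moreover have "convex hull T_im A0 A = convex hull V"
      unfolding vertices_T_im_def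
      by (intro Krein_Milman_Minkowski compact_convex_hull compact_T_im convex_convex_hull)
    then have "t \<in> convex hull V" using t hull_inc by metis
    moreover have "z \<bullet> t = 0" by (auto simp: inner_vec_def z_def intro!: sum.neutral)
    ultimately show False by auto
  qed
  then show ?thesis using that by blast
qed

text \<open>By complementary slackness all forms \<open>\<A>(x)\<close> vanish on the line through \<open>\<tau>\<close> and \<open>\<sigma>\<close>. As \<open>\<tau>\<close> is
  positive wherever \<open>\<sigma>\<close> is, this line can be prolonged a little beyond \<open>\<tau>\<close> without leaving the
  simplex, so that \<open>\<tau>\<close> would lie between two immobile indices if it differed from \<open>\<sigma>\<close>.\<close>

lemma vertex_eq_if_support_le:
  assumes \<tau>: "\<tau> \<in> V" and \<sigma>: "\<sigma> \<in> V" and supp: "\<And>k. \<tau> $ k = 0 \<Longrightarrow> \<sigma> $ k = 0"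
  shows "\<sigma> = \<tau>"
proof (rule ccontr)
  assume neq: "\<sigma> \<noteq> \<tau>"
  have T: "\<tau> \<in> simplex_T" "\<sigma> \<in> simplex_T" using \<tau> \<sigma> vertex_in_simplex_T by auto
  have nn: "0 \<le> \<tau> $ k" "0 \<le> \<sigma> $ k" for k using T by (auto simp: simplex_T_def nonneg_orthant_def)
  have le1: "\<sigma> $ k \<le> 1" for k
    using T(2) member_le_sum[of k UNIV "\<lambda>k. \<sigma> $ k"] nn by (auto simp: simplex_T_def)
  \<comment> \<open>The prolongation is nonnegative for \<open>e \<le> \<tau>\<^sub>k\<close> because \<open>\<sigma>\<^sub>k \<le> 1\<close>; the entry \<open>1\<close> only keeps the
    set visibly nonempty.\<close>
  define e where "e = Min (insert 1 ((\<lambda>k. \<tau> $ k) ` {k. \<tau> $ k \<noteq> 0}))"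
  have "\<tau> $ k > 0" if "\<tau> $ k \<noteq> 0" for k using nn(1)[of k] that by simp
  then have e0: "e > 0" by (auto simp: e_def)
  have e1: "e \<le> \<tau> $ k" if "\<tau> $ k \<noteq> 0" for k using that by (auto simp: e_def)
  define u where "u = (1 + e) *\<^sub>R \<tau> + (- e) *\<^sub>R \<sigma>"
  have "0 \<le> u $ k" for k
  proof (cases "\<tau> $ k = 0")
    case True
    then show ?thesis using supp[OF True] by (simp add: u_def)
  next
    case False
    have "e * \<sigma> $ k \<le> e" using le1[of k] e0 by (simp add: mult_left_le)
    also have "\<dots> \<le> \<tau> $ k" by (rule e1[OF False])
    also have "\<dots> \<le> (1 + e) * \<tau> $ k" using e0 nn(1)[of k] by (simp add: distrib_right)
    finally show ?thesis by (simp add: u_def)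
  qed
  moreover have "(\<Sum>k\<in>UNIV. u $ k) = 1"
    using T by (simp add: u_def simplex_T_def sum_subtractf sum_distrib_left[symmetric])
  ultimately have "u \<in> simplex_T" by (simp add: simplex_T_def nonneg_orthant_def)
  moreover have "u \<bullet> (affine_map A0 A x *v u) = 0" if x: "x \<in> X" for x
  proof -
    note z = T_im_zero[OF vertex_in_T_im[OF \<tau>] x] T_im_zero[OF vertex_in_T_im[OF \<sigma>] x]
    have "\<sigma> \<bullet> (affine_map A0 A x *v \<tau>) = 0"
      by (rule copositive_zero_gradient_support[OF z(1-3)]) (rule supp)
    then show ?thesis
      using z unfolding u_def sym_matrix_form_add_scaleR[OF affine_map_sym]
      by (simp add: matrix_vector_mult_scaleR)
  qed
  ultimately have u: "u \<in> convex hull T_im A0 A" by (auto simp: T_im_def intro!: hull_inc)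
  have s: "\<sigma> \<in> convex hull T_im A0 A" using vertex_in_T_im[OF \<sigma>] by (rule hull_inc)
  have "\<tau> \<in> open_segment u \<sigma>"
    unfolding in_segment
  proof (intro conjI exI)
    have "u - \<sigma> = (1 + e) *\<^sub>R (\<tau> - \<sigma>)" by (simp add: u_def algebra_simps)
    then show "u \<noteq> \<sigma>" using neq e0 by auto
    show "0 < e / (1 + e)" "e / (1 + e) < 1" using e0 by simp_all
    have "1 - e / (1 + e) = 1 / (1 + e)" using e0 by (simp add: field_simps)
    moreover have "(1 / (1 + e)) *\<^sub>R u = \<tau> - (e / (1 + e)) *\<^sub>R \<sigma>"
      using e0 by (simp add: u_def scaleR_right_diff_distrib)
    ultimately show "\<tau> = (1 - e / (1 + e)) *\<^sub>R u + (e / (1 + e)) *\<^sub>R \<sigma>" by simp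
  qed
  then show False using \<tau> u s by (auto simp: vertices_T_im_def extreme_point_of_def)
qed

lemma finite_vertices: "finite V"
proof (rule finite_imageD)
  show "inj_on (\<lambda>\<tau>. {k. \<tau> $ k = 0}) V"
    by (intro inj_onI vertex_eq_if_support_le) blast+
qed simp

text \<open>Each \<open>w\<close> is mobile, i.e. strict at some feasible point, and then so are its neighbours at the same
  point. Compactness leaves finitely many of these points, and their mean is strict everywhere.\<close>

lemma slater_point:
  obtains x where "x \<in> X" "\<And>w. w \<in> supp_free V \<Longrightarrow> 0 < vec_a A0 A w \<bullet> (1, x)"
proof -
  obtain x0 where x0: "x0 \<in> X" using consistent by (auto simp: consistent_def)
  have nn: "0 \<le> vec_a A0 A w \<bullet> (1, x)" if "x \<in> X" "w \<in> supp_free V" for x w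
    using that unfolding feasible_X_eq_solutions by (auto simp: solutions_def supp_free_def)
  have ex: "\<exists>x\<in>X. 0 < vec_a A0 A w \<bullet> (1, x)" if w: "w \<in> supp_free V" for w
  proof (rule ccontr)
    assume "\<not> ?thesis"
    then have "w \<in> T_im A0 A"
      using nn[OF _ w] w by (force simp: T_im_def supp_free_def vec_a_eq coeffs_inner)
    then obtain \<tau> where "\<tau> \<in> V" "\<And>k. w $ k = 0 \<Longrightarrow> \<tau> $ k = 0"
      using immobile_index_supports_vertex by blast
    then show False using w by (auto simp: supp_free_def)
  qed
  define Q where "Q x = {w. 0 < vec_a A0 A w \<bullet> (1, x)}" for x
  have "\<And>x. x \<in> X \<Longrightarrow> open (Q x)"
    unfolding Q_def by (intro open_Collect_less continuous_intros continuous_vec_a)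
  moreover have "supp_free V \<subseteq> (\<Union>x\<in>X. Q x)" using ex by (auto simp: Q_def)
  ultimately obtain F where F: "F \<subseteq> X" "finite F" "supp_free V \<subseteq> (\<Union>x\<in>F. Q x)"
    using compactE_image[OF compact_supp_free, of X Q V] by blast
  \<comment> \<open>The point \<open>x0\<close> is added because \<open>F\<close> may be empty.\<close>
  define G where "G = insert x0 F"
  have G: "finite G" "G \<noteq> {}" "G \<subseteq> X" using F x0 by (auto simp: G_def)
  define c where "c = 1 / real (card G)"
  have c: "c > 0" using G by (simp add: c_def card_gt_0_iff)
  define x where "x = (\<Sum>g\<in>G. c *\<^sub>R g)"
  have one: "(\<Sum>g\<in>G. c) = 1" using G by (simp add: c_def)
  have "x \<in> X"
    unfolding x_def using G c one convex_solutions[of "vec_a A0 A ` simplex_T"]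
    by (intro convex_sum) (auto simp: feasible_X_eq_solutions)
  moreover have "0 < vec_a A0 A w \<bullet> (1, x)" if w: "w \<in> supp_free V" for w
  proof -
    obtain g where g: "g \<in> F" "0 < vec_a A0 A w \<bullet> (1, g)" using F w by (auto simp: Q_def)
    have "(1, x) = (\<Sum>g\<in>G. c *\<^sub>R (1::real, g))"
      using one by (simp add: prod_eq_iff x_def fst_sum snd_sum)
    then have "vec_a A0 A w \<bullet> (1, x) = (\<Sum>g\<in>G. c * (vec_a A0 A w \<bullet> (1, g)))"
      by (simp only: inner_sum_right inner_scaleR_right)
    also have "\<dots> > 0"
      using g G c nn w by (intro sum_pos2[of _ g]) (auto simp: G_def)
    finally show ?thesis .
  qed
  ultimately show ?thesis using that by blast
qed

section \<open>A regular description of the feasible set\<close>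

text \<open>The constraints kept are those \<open>b(k, \<tau>)\<close> that can be active on \<open>X\<close>, finitely many in number,
  and a compact family of \<open>a(w)\<close> that has a common point of strict feasibility.\<close>

definition regular_b :: "(real \<times> (real^'n)) set" where
  "regular_b = (\<Union>\<tau>\<in>V. (\<lambda>k. vec_b A0 A k \<tau>) ` N_star A0 A \<tau>)"

definition regular_a :: "(real \<times> (real^'n)) set" where
  "regular_a = vec_a A0 A ` supp_free V"

lemma feasible_X_subset_regular: "X \<subseteq> solutions (regular_b \<union> regular_a)"
proof
  fix x assume x: "x \<in> X"
  moreover have "x \<in> solutions (vec_a A0 A ` simplex_T)" using x feasible_X_eq_solutions by simp
  ultimately show "x \<in> solutions (regular_b \<union> regular_a)"
    unfolding solutions_def regular_b_def regular_a_def using vec_b_nonneg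
    by (auto simp: supp_free_def)
qed

text \<open>The dropped inequalities \<open>b(k, \<tau>) \<ge> 0\<close>, \<open>k \<notin> N\<^sub>*(\<tau>)\<close>, are never active on \<open>X\<close>. Hence \<open>X\<close> is
  the part of the regular solution set where finitely many of them hold strictly, which is relatively
  open, but \<open>X\<close> is also closed. The regular solution set is convex and so connected.\<close>

lemma feasible_X_eq_regular: "X = solutions (regular_b \<union> regular_a)"
proof -
  let ?Y = "solutions (regular_b \<union> regular_a)"
  define P where "P = (\<Inter>\<tau>\<in>V. \<Inter>k\<in>- N_star A0 A \<tau>. {x. 0 < vec_b A0 A k \<tau> \<bullet> (1, x)})"
  have "open P"
    unfolding P_def using finite_vertices
    by (intro open_INT ballI open_Collect_less continuous_intros) auto
  have "X = ?Y \<inter> P"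
  proof (intro equalityI subsetI)
    fix x assume x: "x \<in> X"
    then have "vec_b A0 A k \<tau> \<bullet> (1, x) \<noteq> 0" if "k \<notin> N_star A0 A \<tau>" for k \<tau>
      using that by (auto simp: N_star_def vec_b_eq coeffs_inner)
    then have "x \<in> P" unfolding P_def using vec_b_nonneg[OF _ x] by (force simp: less_le)
    then show "x \<in> ?Y \<inter> P" using x feasible_X_subset_regular by auto
  next
    fix x assume x: "x \<in> ?Y \<inter> P"
    have "affine_map A0 A x \<in> COP"
    proof (rule copositive_peeling[OF affine_map_sym, of V])
      show "V \<subseteq> simplex_T" using vertex_in_simplex_T by blast
      show "0 \<le> axis k 1 \<bullet> (affine_map A0 A x *v \<tau>)" if "\<tau> \<in> V" for \<tau> k
      proof -
        have "0 \<le> vec_b A0 A k \<tau> \<bullet> (1, x)"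
          using x that by (cases "k \<in> N_star A0 A \<tau>")
            (auto simp: P_def solutions_def regular_b_def intro: less_imp_le)
        then show ?thesis by (simp add: vec_b_eq coeffs_inner)
      qed
      show "0 \<le> w \<bullet> (affine_map A0 A x *v w)" if "w \<in> supp_free V" for w
        using x that by (simp add: solutions_def regular_a_def vec_a_eq coeffs_inner[symmetric])
    qed
    then show "x \<in> X" by (simp add: feasible_X_def)
  qed
  then have "openin (top_of_set ?Y) X" using \<open>open P\<close> by (auto simp: openin_open)
  moreover have "closedin (top_of_set ?Y) X"
    using feasible_X_subset_regular closed_solutions
    by (metis feasible_X_eq_solutions closed_subset)
  moreover have "connected ?Y" by (intro convex_connected convex_solutions)
  moreover have "X \<noteq> {}" using consistent by (simp add: consistent_def)
  ultimately show ?thesis unfolding connected_clopen by blast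
qed

lemma consequences_subset_regular_cone:
  "consequences X \<subseteq> convex_cone hull (insert (1, 0) (regular_b \<union> regular_a))"
proof -
  obtain x where x: "x \<in> X" "\<And>w. w \<in> supp_free V \<Longrightarrow> 0 < vec_a A0 A w \<bullet> (1, x)"
    using slater_point by blast
  have "consequences (solutions (regular_b \<union> regular_a))
      \<subseteq> convex_cone hull (insert (1, 0) (regular_b \<union> regular_a))"
  proof (rule slater_farkas)
    show "finite regular_b"
      unfolding regular_b_def using finite_vertices by auto
    show "compact regular_a"
      unfolding regular_a_def by (intro compact_continuous_image continuous_vec_a compact_supp_free)
    show "x \<in> solutions regular_b"
      using x(1) feasible_X_subset_regular by (auto simp: solutions_def)
    show "0 < s \<bullet> (1, x)" if "s \<in> regular_a" for s
      using that x(2) by (auto simp: regular_a_def)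
  qed
  then show ?thesis using feasible_X_eq_regular by simp
qed

section \<open>Uniform duality as a cone inclusion\<close>

lemma vec_a_cone_subset_consequences:
  "convex_cone hull (vec_a A0 A ` simplex_T) \<subseteq> consequences X"
  unfolding feasible_X_eq_solutions by (rule convex_cone_hull_subset_consequences)

lemma pairing_in_cone: "U \<in> CP \<Longrightarrow> pairing A0 A U \<in> convex_cone hull (vec_a A0 A ` simplex_T)"
  using pairing_CP[of A0 A] unfolding cone_gen_eq_hull by blast

lemma feasible_D_iff: "U \<in> feasible_D A c \<longleftrightarrow> U \<in> CP \<and> pairing A0 A U = (mat_inner U A0, c)"
  by (auto simp: feasible_D_def pairing_def vec_eq_iff)

lemma weak_duality:
  assumes "U \<in> feasible_D A c" "x \<in> X"
  shows "- mat_inner U A0 \<le> c \<bullet> x"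
proof -
  have "pairing A0 A U \<in> consequences X"
    using assms(1) pairing_in_cone vec_a_cone_subset_consequences unfolding feasible_D_iff by blast
  then have "0 \<le> pairing A0 A U \<bullet> (1, x)"
    using assms(2) by (simp only: consequences_def mem_Collect_eq)
  moreover have "pairing A0 A U = (mat_inner U A0, c)"
    using assms(1) by (simp only: feasible_D_iff)
  ultimately show ?thesis by simp
qed

lemma val_D_optimal: "optimal_D A0 A c U \<Longrightarrow> val_D A0 A c = ereal (- mat_inner U A0)"
  unfolding val_D_def optimal_D_def by (intro SUP_eqI) auto

text \<open>The primal value is finite exactly if some \<open>(r, c)\<close> is a consequence, and then \<open>- Val(P)\<close> is the
  smallest such \<open>r\<close>. The multiple of \<open>(1, 0)\<close> absorbs the slack of the others; for the smallest one
  it vanishes by weak duality.\<close>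

lemma uniform_LP_duality_iff:
  "uniform_LP_duality A0 A \<longleftrightarrow>
    consequences X \<subseteq> convex_cone hull (insert (1, 0) (vec_a A0 A ` simplex_T))"
proof
  assume dual: "uniform_LP_duality A0 A"
  show "consequences X \<subseteq> convex_cone hull (insert (1, 0) (vec_a A0 A ` simplex_T))"
  proof
    fix y assume y: "y \<in> consequences X"
    obtain r c where rc: "y = (r, c)" by (cases y)
    have "- r \<le> c \<bullet> x" if "x \<in> X" for x
      using y that by (force simp: rc consequences_def)
    then have r: "ereal (- r) \<le> val_P A0 A c"
      unfolding val_P_def by (intro INF_greatest) simp
    then have "val_P A0 A c > -\<infinity>" by (cases "val_P A0 A c") auto
    then obtain U where U: "optimal_D A0 A c U" "val_P A0 A c = val_D A0 A c"
      using dual unfolding uniform_LP_duality_def by blast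
    have "- r \<le> - mat_inner U A0" using r U val_D_optimal[OF U(1)] by simp
    moreover have "(mat_inner U A0, c) \<in> convex_cone hull (vec_a A0 A ` simplex_T)"
      using U(1) pairing_in_cone unfolding optimal_D_def feasible_D_iff by metis
    ultimately show "y \<in> convex_cone hull (insert (1, 0) (vec_a A0 A ` simplex_T))"
      unfolding mem_convex_cone_hull_insert_unit
      by (intro exI[of _ "r - mat_inner U A0"]) (simp add: rc)
  qed
next
  assume incl: "consequences X \<subseteq> convex_cone hull (insert (1, 0) (vec_a A0 A ` simplex_T))"
  show "uniform_LP_duality A0 A"
    unfolding uniform_LP_duality_def
  proof (intro allI impI)
    fix c assume fin: "val_P A0 A c > -\<infinity>"
    obtain x0 where "x0 \<in> X" using consistent by (auto simp: consistent_def)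
    then have "val_P A0 A c \<le> ereal (c \<bullet> x0)" unfolding val_P_def by (rule INF_lower)
    then obtain v where v: "val_P A0 A c = ereal v" using fin by (cases "val_P A0 A c") auto
    have "v \<le> c \<bullet> x" if "x \<in> X" for x
      using that v INF_lower[of x X "\<lambda>x. ereal (c \<bullet> x)"] by (simp add: val_P_def)
    then have "(- v, c) \<in> consequences X" by (auto simp: consequences_def)
    then obtain s where s: "s \<ge> 0" "(- v - s, c) \<in> convex_cone hull (vec_a A0 A ` simplex_T)"
      using incl mem_convex_cone_hull_insert_unit by fastforce
    then obtain U where U: "U \<in> CP" "pairing A0 A U = (- v - s, c)"
      using pairing_CP[of A0 A] unfolding cone_gen_eq_hull by (metis imageE)
    then have U': "U \<in> feasible_D A c" "- mat_inner U A0 = v + s"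
      unfolding feasible_D_iff by (auto simp: pairing_def)
    have bound: "- mat_inner W A0 \<le> v" if "W \<in> feasible_D A c" for W
    proof -
      have "ereal (- mat_inner W A0) \<le> val_P A0 A c"
        unfolding val_P_def using weak_duality[OF that] by (intro INF_greatest) simp
      then show ?thesis by (simp add: v)
    qed
    have "- mat_inner U A0 = v" using bound[OF U'(1)] U'(2) s(1) by simp
    then have "optimal_D A0 A c U" using U'(1) bound by (simp add: optimal_D_def)
    then show "(\<exists>U. optimal_D A0 A c U) \<and> val_P A0 A c = val_D A0 A c"
      using val_D_optimal v \<open>- mat_inner U A0 = v\<close> by metis
  qed
qed

text \<open>At a feasible point where \<open>b(k, \<tau>)\<close> is active, the multiple of \<open>(1, 0)\<close> in its representation must
  be zero, as the remaining part is nonnegative there.\<close>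

lemma vec_b_in_cone_if_duality:
  assumes "uniform_LP_duality A0 A" and \<tau>: "\<tau> \<in> V" and k: "k \<in> N_star A0 A \<tau>"
  shows "vec_b A0 A k \<tau> \<in> convex_cone hull (vec_a A0 A ` simplex_T)"
proof -
  obtain x where x: "x \<in> X" "vec_b A0 A k \<tau> \<bullet> (1, x) = 0"
    using k by (auto simp: N_star_def vec_b_eq coeffs_inner)
  have "vec_b A0 A k \<tau> \<in> consequences X" using vec_b_nonneg[OF \<tau>] by (simp add: consequences_def)
  then obtain s where s: "s \<ge> 0"
      "vec_b A0 A k \<tau> - (s, 0) \<in> convex_cone hull (vec_a A0 A ` simplex_T)"
    using assms(1) unfolding uniform_LP_duality_iff using mem_convex_cone_hull_insert_unit by blast
  then have "0 \<le> (vec_b A0 A k \<tau> - (s, 0)) \<bullet> (1, x)"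
    using vec_a_cone_subset_consequences x(1) by (auto simp: consequences_def)
  then have "s = 0" using x(2) s(1) by (simp add: inner_diff_left)
  then show ?thesis using s(2) by (simp add: zero_prod_def[symmetric])
qed

lemma duality_if_vec_b_in_cone:
  assumes "regular_b \<subseteq> convex_cone hull (vec_a A0 A ` simplex_T)"
  shows "uniform_LP_duality A0 A"
  unfolding uniform_LP_duality_iff
proof (rule subset_trans[OF consequences_subset_regular_cone])
  let ?K = "convex_cone hull (insert (1, 0) (vec_a A0 A ` simplex_T))"
  have K: "convex_cone hull (vec_a A0 A ` simplex_T) \<subseteq> ?K" by (intro hull_mono) auto
  have "regular_a \<subseteq> vec_a A0 A ` simplex_T" by (auto simp: regular_a_def supp_free_def)
  then have "regular_a \<subseteq> ?K" by (rule subset_trans[OF _ subset_trans[OF hull_subset K]])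
  moreover have "regular_b \<subseteq> ?K" using assms K by (rule subset_trans)
  moreover have "(1, 0) \<in> ?K" by (simp add: hull_inc)
  ultimately have "insert (1, 0) (regular_b \<union> regular_a) \<subseteq> ?K"
    by (intro insert_subsetI Un_least)
  then show "convex_cone hull (insert (1, 0) (regular_b \<union> regular_a)) \<subseteq> ?K"
    by (intro hull_minimal convex_cone_convex_cone_hull)
qed

end

theorem proposition3:
  fixes A0 :: "real^'p^'p" and A :: "'n::finite \<Rightarrow> real^'p^'p"
  assumes "CARD('p) > 1"
    and "A0 \<in> sym_matrices" and "\<And>m. A m \<in> sym_matrices"
    and "consistent A0 A"
  shows "uniform_LP_duality A0 A \<longleftrightarrow>
    (\<forall>\<tau>\<in>vertices_T_im A0 A. \<forall>k\<in>N_star A0 A \<tau>.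
       vec_b A0 A k \<tau> \<in> cone_gen (vec_a A0 A ` simplex_T))"
proof -
  interpret copositive_system A0 A using assms(2-4) by unfold_locales
  show ?thesis
    unfolding cone_gen_eq_hull
    using vec_b_in_cone_if_duality duality_if_vec_b_in_cone by (auto simp: regular_b_def)
qed

end
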